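(* Let $(B,+,\circ)$ be a semi-brace, and let $\lambda_a:B\to B$, $\lambda_a(b)=a\circ(a^-+b)$, for all $a,b\in B$. Then the map $\sigma:B\to B^B$, $a\mapsto\lambda_{a^-}$, is an affine structure on the group $(B,\circ)$. Moreover, $a+b=a\circ\sigma_a(b)$ for all $a,b\in B$; that is, the semi-brace $B_\sigma$ coincides with $B$. In addition, under this correspondence, cancellative affine structures correspond to left cancellative semi-braces and groupal affine structures correspond to skew braces (that is, $\sigma$ is cancellative if and only if $B$ is left cancellative, and $\sigma$ is groupal if and only if $B$ is a skew brace).
   Context: For a group $(B,\circ)$, $0$ denotes its identity and $a^-$ the inverse of $a$. $B^B$ is the monoid (under composition) of all maps $B\to B$ and $\mathrm{Sym}_B$ is the symmetric group on $B$. For $\sigma:B\to B^B$ write $\sigma_a:=\sigma(a)$; juxtaposition of maps is composition. An affine structure on $(B,\circ)$ is a map $\sigma:B\to B^B$ that is a semigroup anti-homomorphism, i.e. $\sigma_{a\circ b}=\sigma_b\sigma_a$ for all $a,b\in B$ (it is not required that $\sigma_0=\mathrm{id}_B$), such that $\sigma_a(b\circ\sigma_b(c))=\sigma_a(b)\circ\sigma_{\sigma_a(b)}\sigma_a(c)$ for all $a,b,c\in B$. It is cancellative if $\sigma(B)\subseteq \mathrm{Sym}_B$, and groupal if it is cancellative and $\sigma_a(0)=0$ for every $a\in B$. A (left) semi-brace is a set $B$ with two binary operations $+,\circ$ such that $(B,+)$ is a semigroup, $(B,\circ)$ is a group, and $a\circ(b+c)=a\circ b+a\circ(a^-+c)$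 for all $a,b,c\in B$ ($\circ$ has higher precedence than $+$). It is left cancellative if the semigroup $(B,+)$ is left cancellative; it is a skew brace if $(B,+)$ is a group. For an affine structure $\sigma$ on $(B,\circ)$, $B_\sigma$ denotes the semi-brace with multiplication $\circ$ and addition $a+b:=a\circ\sigma_a(b)$. *)

theory Defs
  imports "HOL-Algebra.Group" "HOL-Algebra.Bij"
begin

(* In the text the multiplication is written as a circle and its identity as 0;
   here these are the \<otimes> and \<one> inherited from monoid.  The additive
   operation is \<boxplus>. *)
record 'a semi_brace_struct = "'a monoid" +
  sb_add :: "['a, 'a] \<Rightarrow> 'a" (infixl "\<boxplus>\<index>" 65)

locale semi_brace = group B for B (structure) +
  assumes add_closed:
      "\<lbrakk>a \<in> carrier B; b \<in> carrier B\<rbrakk> \<Longrightarrow> a \<boxplus> b \<in> carrier B"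
    and add_assoc:
      "\<lbrakk>a \<in> carrier B; b \<in> carrier B; c \<in> carrier B\<rbrakk>
        \<Longrightarrow> (a \<boxplus> b) \<boxplus> c = a \<boxplus> (b \<boxplus> c)"
    and semi_brace_distrib:
      "\<lbrakk>a \<in> carrier B; b \<in> carrier B; c \<in> carrier B\<rbrakk>
        \<Longrightarrow> a \<otimes> (b \<boxplus> c) = a \<otimes> b \<boxplus> a \<otimes> (inv a \<boxplus> c)"

locale left_cancellative_semi_brace = semi_brace +
  assumes add_left_cancel:
      "\<lbrakk>a \<in> carrier B; b \<in> carrier B; c \<in> carrier B; a \<boxplus> b = a \<boxplus> c\<rbrakk> \<Longrightarrow> b = c"

(* The additive identity e is not assumed to be the multiplicative one. *)
locale skew_brace = semi_brace +
  assumes add_group: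
      "\<exists>e. group \<lparr>carrier = carrier B, mult = (\<boxplus>), one = e\<rparr>"

(* Maps on the carrier are represented by extensional functions, so that equality of
   maps is HOL equality; compose (carrier G) is composition in the monoid of all
   self-maps of the carrier and Bij (carrier G) is its symmetric group. *)
locale affine_structure = group G for G (structure) and \<sigma> :: "'a \<Rightarrow> 'a \<Rightarrow> 'a" +
  assumes sigma_maps: "\<sigma> \<in> carrier G \<rightarrow>\<^sub>E (carrier G \<rightarrow>\<^sub>E carrier G)"
    and sigma_antihom:
      "\<lbrakk>a \<in> carrier G; b \<in> carrier G\<rbrakk> \<Longrightarrow> \<sigma> (a \<otimes> b) = compose (carrier G) (\<sigma> b) (\<sigma> a)"
    and sigma_affine:
      "\<lbrakk>a \<in> carrier G; b \<in> carrier G; c \<in> carrier G\<rbrakk>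
        \<Longrightarrow> \<sigma> a (b \<otimes> \<sigma> b c) = \<sigma> a b \<otimes> \<sigma> (\<sigma> a b) (\<sigma> a c)"

locale cancellative_affine_structure = affine_structure +
  assumes sigma_Sym: "\<sigma> ` carrier G \<subseteq> Bij (carrier G)"

locale groupal_affine_structure = cancellative_affine_structure +
  assumes sigma_one: "a \<in> carrier G \<Longrightarrow> \<sigma> a \<one> = \<one>"

definition semi_brace_of_affine ::
    "('a, 'b) monoid_scheme \<Rightarrow> ('a \<Rightarrow> 'a \<Rightarrow> 'a) \<Rightarrow> 'a semi_brace_struct" where
  "semi_brace_of_affine G \<sigma> =
    \<lparr>carrier = carrier G, mult = mult G, one = one G, sb_add = (\<lambda>a b. a \<otimes>\<^bsub>G\<^esub> \<sigma> a b)\<rparr>"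

definition sb_lambda :: "('a, 'b) semi_brace_struct_scheme \<Rightarrow> 'a \<Rightarrow> 'a \<Rightarrow> 'a" where
  "sb_lambda B a = (\<lambda>b\<in>carrier B. a \<otimes>\<^bsub>B\<^esub> (inv\<^bsub>B\<^esub> a \<boxplus>\<^bsub>B\<^esub> b))"

definition sb_sigma :: "('a, 'b) semi_brace_struct_scheme \<Rightarrow> 'a \<Rightarrow> 'a \<Rightarrow> 'a" where
  "sb_sigma B = (\<lambda>a\<in>carrier B. sb_lambda B (inv\<^bsub>B\<^esub> a))"

(* Record equality would also compare the operations outside the carrier, where they
   have no meaning. *)
definition same_semi_brace ::
    "('a, 'b) semi_brace_struct_scheme \<Rightarrow> ('a, 'c) semi_brace_struct_scheme \<Rightarrow> bool" where
  "same_semi_brace A B \<longleftrightarrow> carrier A = carrier B \<and>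
    (\<forall>a\<in>carrier B. \<forall>b\<in>carrier B.
      a \<otimes>\<^bsub>A\<^esub> b = a \<otimes>\<^bsub>B\<^esub> b \<and> a \<boxplus>\<^bsub>A\<^esub> b = a \<boxplus>\<^bsub>B\<^esub> b)"

end

theory Submission
  imports Defs
begin

text \<open>Write \<open>\<sigma>\<^sub>a(b) = a\<^sup>- \<circ> (a + b)\<close>.  Left multiplication by \<open>a\<^sup>-\<close> turns the semi-brace law into
  the anti-homomorphism property (applied to \<open>a \<circ> b + c\<close>) and, together with associativity, into
  \<open>\<sigma>\<^sub>a(b + c) = \<sigma>\<^sub>a(b) + \<sigma>\<^sub>a(c)\<close>, which is the affine law.  The map \<open>\<sigma>\<^sub>0\<close> is idempotent, so as soon as
  it is injective it is the identity and every \<open>\<sigma>\<^sub>a\<close> is invertible with inverse \<open>\<sigma>\<^bsub>a\<^sup>-\<^esub>\<close>.  It also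
  follows that \<open>0\<close> is then a left identity for \<open>+\<close>, hence the neutral element whenever \<open>(B,+)\<close> is a
  group.\<close>

context affine_structure
begin

lemma sigma_closed [simp, intro]:
  "\<lbrakk>a \<in> carrier G; b \<in> carrier G\<rbrakk> \<Longrightarrow> \<sigma> a b \<in> carrier G"
  using sigma_maps by (auto simp: PiE_iff)

lemma sigma_extensional: "a \<in> carrier G \<Longrightarrow> \<sigma> a \<in> extensional (carrier G)"
  using sigma_maps by (auto simp: PiE_iff)

lemma sigma_mult:
  "\<lbrakk>a \<in> carrier G; b \<in> carrier G; c \<in> carrier G\<rbrakk> \<Longrightarrow> \<sigma> (a \<otimes> b) c = \<sigma> b (\<sigma> a c)"
  by (simp add: sigma_antihom compose_eq)

lemma sigma_sigma_one:
  "\<lbrakk>a \<in> carrier G; c \<in> carrier G\<rbrakk> \<Longrightarrow> \<sigma> a (\<sigma> \<one> c) = \<sigma> a c"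
  using sigma_mult[of \<one> a c] by simp

lemma sigma_inv_right:
  "\<lbrakk>a \<in> carrier G; c \<in> carrier G\<rbrakk> \<Longrightarrow> \<sigma> a (\<sigma> (inv a) c) = \<sigma> \<one> c"
  using sigma_mult[of "inv a" a c] by simp

lemma sigma_one_eq_id:
  assumes "inj_on (\<sigma> \<one>) (carrier G)" "c \<in> carrier G"
  shows "\<sigma> \<one> c = c"
  using assms sigma_sigma_one[of \<one> c] by (simp add: inj_on_eq_iff)

text \<open>Surjectivity is automatic, so membership in \<open>Bij\<close> reduces to injectivity,
  the form that compares directly with left cancellation of \<open>\<boxplus>\<close>.\<close>

lemma cancellative_iff_inj:
  "cancellative_affine_structure G \<sigma> \<longleftrightarrow> (\<forall>a\<in>carrier G. inj_on (\<sigma> a) (carrier G))"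
proof
  assume "cancellative_affine_structure G \<sigma>"
  then interpret cancellative_affine_structure G \<sigma> .
  show "\<forall>a\<in>carrier G. inj_on (\<sigma> a) (carrier G)"
    using sigma_Sym by (auto simp: Bij_def bij_betw_def)
next
  assume inj: "\<forall>a\<in>carrier G. inj_on (\<sigma> a) (carrier G)"
  have "\<sigma> a ` carrier G = carrier G" if a: "a \<in> carrier G" for a
  proof -
    \<comment> \<open>The explicit preimage of \<open>c\<close> works because
      \<open>\<sigma> a\<close> after \<open>\<sigma> (inv a)\<close> is
      \<open>\<sigma> \<one>\<close>, the identity once it is injective.\<close>
    have "c = \<sigma> a (\<sigma> (inv a) c)" if "c \<in> carrier G" for c
      using a that inj by (simp add: sigma_inv_right sigma_one_eq_id)
    then show ?thesis using a by (blast intro: inv_closed)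
  qed
  then show "cancellative_affine_structure G \<sigma>"
    using inj sigma_extensional
    by unfold_locales (auto simp: Bij_def bij_betw_def)
qed

text \<open>Once the anti-homomorphism property splits
  \<open>\<sigma> (a \<otimes> \<sigma> a b)\<close>, associativity of the addition is the affine
  law multiplied by \<open>a\<close>.\<close>

theorem semi_brace_semi_brace_of_affine: "semi_brace (semi_brace_of_affine G \<sigma>)"
proof -
  let ?B = "semi_brace_of_affine G \<sigma>"
  have [simp]: "carrier ?B = carrier G" "mult ?B = mult G" "one ?B = one G"
    "sb_add ?B = (\<lambda>a b. a \<otimes> \<sigma> a b)"
    by (simp_all add: semi_brace_of_affine_def)
  have [simp]: "m_inv ?B = m_inv G"
    by (simp add: m_inv_def fun_eq_iff)
  have "group ?B"
    by (rule groupI) (auto simp: m_assoc intro: l_inv_ex)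
  then show ?thesis
  proof (intro semi_brace.intro semi_brace_axioms.intro)
    fix a b c
    assume "a \<in> carrier ?B" "b \<in> carrier ?B" "c \<in> carrier ?B"
    then have abc: "a \<in> carrier G" "b \<in> carrier G" "c \<in> carrier G"
      by simp_all
    show "a \<boxplus>\<^bsub>?B\<^esub> b \<boxplus>\<^bsub>?B\<^esub> c = a \<boxplus>\<^bsub>?B\<^esub> (b \<boxplus>\<^bsub>?B\<^esub> c)"
      using abc by (simp add: sigma_affine sigma_mult m_assoc)
    \<comment> \<open>This simplifies the second summand of the semi-brace law. Applying
      \<open>\<sigma> (a \<otimes> b)\<close> to it then leaves
      \<open>\<sigma> b (\<sigma> \<one> c)\<close>, which is \<open>\<sigma> b c\<close> even if
      \<open>\<sigma> \<one>\<close> is not the identity.\<close>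
    have "a \<otimes> (inv a \<otimes> \<sigma> (inv a) c) = \<sigma> (inv a) c"
      using abc by (simp flip: m_assoc)
    then show "a \<otimes>\<^bsub>?B\<^esub> (b \<boxplus>\<^bsub>?B\<^esub> c) = a \<otimes>\<^bsub>?B\<^esub> b \<boxplus>\<^bsub>?B\<^esub> a \<otimes>\<^bsub>?B\<^esub> (inv\<^bsub>?B\<^esub> a \<boxplus>\<^bsub>?B\<^esub> c)"
      using abc by (simp add: sigma_mult sigma_inv_right sigma_sigma_one m_assoc)
  qed auto
qed

end

context semi_brace
begin

lemma sb_sigma_eq:
  "\<lbrakk>a \<in> carrier B; b \<in> carrier B\<rbrakk> \<Longrightarrow> sb_sigma B a b = inv a \<otimes> (a \<boxplus> b)"
  by (simp add: sb_sigma_def sb_lambda_def)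

lemma add_eq_mult_sb_sigma:
  "\<lbrakk>a \<in> carrier B; b \<in> carrier B\<rbrakk> \<Longrightarrow> a \<boxplus> b = a \<otimes> sb_sigma B a b"
  by (simp add: sb_sigma_eq add_closed flip: m_assoc)

lemma sb_sigma_maps: "sb_sigma B \<in> carrier B \<rightarrow>\<^sub>E (carrier B \<rightarrow>\<^sub>E carrier B)"
  by (auto simp: sb_sigma_def sb_lambda_def add_closed)

lemma sb_sigma_closed:
  "\<lbrakk>a \<in> carrier B; b \<in> carrier B\<rbrakk> \<Longrightarrow> sb_sigma B a b \<in> carrier B"
  by (simp add: sb_sigma_eq add_closed)

text \<open>The semi-brace law at \<open>inv a\<close>: the inner inverse becomes \<open>a\<close>,
  so the second summand is a value of \<open>sb_sigma B a\<close>.\<close>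

lemma inv_mult_add:
  assumes "a \<in> carrier B" "b \<in> carrier B" "c \<in> carrier B"
  shows "inv a \<otimes> (b \<boxplus> c) = inv a \<otimes> b \<boxplus> sb_sigma B a c"
  using assms semi_brace_distrib[of "inv a" b c] by (simp add: sb_sigma_eq)

lemma sb_sigma_mult:
  assumes "a \<in> carrier B" "b \<in> carrier B" "c \<in> carrier B"
  shows "sb_sigma B (a \<otimes> b) c = sb_sigma B b (sb_sigma B a c)"
proof -
  have "inv a \<otimes> (a \<otimes> b \<boxplus> c) = b \<boxplus> sb_sigma B a c"
    using assms by (simp add: inv_mult_add flip: m_assoc)
  \<comment> \<open>Left multiplication by \<open>inv b\<close> gives the claim, since
    \<open>inv (a \<otimes> b)\<close> is \<open>inv b \<otimes> inv a\<close>.\<close>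
  then show ?thesis
    using assms by (simp add: sb_sigma_eq[of "a \<otimes> b"] sb_sigma_eq[of b] sb_sigma_closed
        inv_mult_group m_assoc add_closed)
qed

lemma sb_sigma_add:
  assumes "a \<in> carrier B" "b \<in> carrier B" "c \<in> carrier B"
  shows "sb_sigma B a (b \<boxplus> c) = sb_sigma B a b \<boxplus> sb_sigma B a c"
  using assms inv_mult_add[of a "a \<boxplus> b" c]
  by (simp add: sb_sigma_eq add_closed add_assoc)

lemma affine_structure_sb_sigma: "affine_structure B (sb_sigma B)"
proof
  show "sb_sigma B \<in> carrier B \<rightarrow>\<^sub>E (carrier B \<rightarrow>\<^sub>E carrier B)"
    by (rule sb_sigma_maps)
next
  fix a b
  assume ab: "a \<in> carrier B" "b \<in> carrier B"
  show "sb_sigma B (a \<otimes> b) = compose (carrier B) (sb_sigma B b) (sb_sigma B a)"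
  proof (rule extensionalityI)
    show "sb_sigma B (a \<otimes> b) \<in> extensional (carrier B)"
      using ab sb_sigma_maps by (auto simp: PiE_iff)
  qed (use ab in \<open>simp_all add: sb_sigma_mult compose_eq\<close>)
next
  fix a b c
  assume "a \<in> carrier B" "b \<in> carrier B" "c \<in> carrier B"
  then show "sb_sigma B a (b \<otimes> sb_sigma B b c) =
      sb_sigma B a b \<otimes> sb_sigma B (sb_sigma B a b) (sb_sigma B a c)"
    \<comment> \<open>Folding each \<open>x \<otimes> sb_sigma B x y\<close> back into
      \<open>x \<boxplus> y\<close> turns the affine law into additivity of
      \<open>sb_sigma B a\<close>.\<close>
    by (simp add: sb_sigma_add sb_sigma_closed flip: add_eq_mult_sb_sigma)
qed

sublocale sigma: affine_structure B "sb_sigma B"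
  by (rule affine_structure_sb_sigma)

text \<open>The two maps differ by left multiplication by \<open>a\<close>, which is
  injective.\<close>

lemma inj_sb_sigma_iff:
  assumes "a \<in> carrier B"
  shows "inj_on (sb_sigma B a) (carrier B) \<longleftrightarrow> inj_on (\<lambda>b. a \<boxplus> b) (carrier B)"
  using assms by (simp add: inj_on_def add_eq_mult_sb_sigma sb_sigma_closed)

lemma left_cancellative_iff_inj:
  "left_cancellative_semi_brace B \<longleftrightarrow> (\<forall>a\<in>carrier B. inj_on (\<lambda>b. a \<boxplus> b) (carrier B))"
  unfolding left_cancellative_semi_brace_def left_cancellative_semi_brace_axioms_def inj_on_def
  using semi_brace_axioms by blast

lemma cancellative_iff_left_cancellative:
  "cancellative_affine_structure B (sb_sigma B) \<longleftrightarrow> left_cancellative_semi_brace B"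
  by (simp add: sigma.cancellative_iff_inj left_cancellative_iff_inj inj_sb_sigma_iff)

lemma left_cancellative_one_add:
  assumes "left_cancellative_semi_brace B" "b \<in> carrier B"
  shows "\<one> \<boxplus> b = b"
proof -
  have "inj_on (sb_sigma B \<one>) (carrier B)"
    using assms(1) by (simp add: left_cancellative_iff_inj inj_sb_sigma_iff)
  with assms(2) show ?thesis
    by (simp add: add_eq_mult_sb_sigma sigma.sigma_one_eq_id)
qed

lemma sb_sigma_one_iff:
  assumes "a \<in> carrier B"
  shows "sb_sigma B a \<one> = \<one> \<longleftrightarrow> a \<boxplus> \<one> = a"
  using assms by (simp add: add_eq_mult_sb_sigma sb_sigma_closed)

lemma groupal_iff_skew_brace:
  "groupal_affine_structure B (sb_sigma B) \<longleftrightarrow> skew_brace B"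
proof
  assume "groupal_affine_structure B (sb_sigma B)"
  then interpret g: groupal_affine_structure B "sb_sigma B" .
  have cancel: "left_cancellative_semi_brace B"
    using cancellative_iff_left_cancellative g.cancellative_affine_structure_axioms by blast
  have one_add: "\<one> \<boxplus> b = b" if "b \<in> carrier B" for b
    using cancel that by (rule left_cancellative_one_add)
  have add_one: "a \<boxplus> \<one> = a" if "a \<in> carrier B" for a
    using that g.sigma_one sb_sigma_one_iff by blast
  have right_neg: "\<exists>b\<in>carrier B. a \<boxplus> b = \<one>" if a: "a \<in> carrier B" for a
  proof -
    have "sb_sigma B a ` carrier B = carrier B"
      using g.sigma_Sym a by (auto simp: Bij_def bij_betw_def)
    \<comment> \<open>A preimage of \<open>inv a\<close> is a right negative of \<open>a\<close>, as
      \<open>a \<boxplus> b\<close> is \<open>a \<otimes> sb_sigma B a b\<close>.\<close>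
    then obtain b where "b \<in> carrier B" "sb_sigma B a b = inv a"
      using a by (metis imageE inv_closed)
    with a show ?thesis by (metis add_eq_mult_sb_sigma r_inv)
  qed
  have left_neg: "\<exists>b\<in>carrier B. b \<boxplus> a = \<one>" if a: "a \<in> carrier B" for a
  proof -
    obtain b where b: "b \<in> carrier B" "a \<boxplus> b = \<one>" using right_neg a by blast
    obtain c where c: "c \<in> carrier B" "b \<boxplus> c = \<one>" using right_neg b(1) by blast
    \<comment> \<open>Evaluate \<open>a \<boxplus> b \<boxplus> c\<close> with both
      bracketings.\<close>
    have "a = c" using a b c by (metis add_assoc add_one one_add)
    with b c show ?thesis by blast
  qed
  have "group \<lparr>carrier = carrier B, mult = (\<boxplus>), one = \<one>\<rparr>"
    by (rule groupI) (auto simp: add_closed add_assoc one_add left_neg)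
  then show "skew_brace B"
    by unfold_locales blast
next
  assume "skew_brace B"
  then obtain e where "group \<lparr>carrier = carrier B, mult = (\<boxplus>), one = e\<rparr>"
    using skew_brace.add_group by blast
  then interpret add: group "\<lparr>carrier = carrier B, mult = (\<boxplus>), one = e\<rparr>" .
  have cancel: "left_cancellative_semi_brace B"
    using add.Units_l_cancel add.Units_eq by unfold_locales simp
  \<comment> \<open>The sum \<open>\<one> \<boxplus> e\<close> equals \<open>e\<close> because
    \<open>\<one>\<close> is a left identity by cancellation, and equals \<open>\<one>\<close>
    because \<open>e\<close> is neutral.\<close>
  have "\<one> = e"
    using left_cancellative_one_add[OF cancel, of e] add.r_one[of \<one>] add.one_closed by simp
  then have "sb_sigma B a \<one> = \<one>" if "a \<in> carrier B" for a
    using that add.r_one[of a] sb_sigma_one_iff[of a] by simp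
  then show "groupal_affine_structure B (sb_sigma B)"
    using cancel
    by (simp add: groupal_affine_structure_def groupal_affine_structure_axioms_def
        cancellative_iff_left_cancellative)
qed

end

theorem theorem10:
  fixes B (structure)
  assumes "semi_brace B"
  shows "affine_structure B (sb_sigma B) \<and>
    (\<forall>a\<in>carrier B. \<forall>b\<in>carrier B. a \<boxplus> b = a \<otimes> sb_sigma B a b) \<and>
    semi_brace (semi_brace_of_affine B (sb_sigma B)) \<and>
    same_semi_brace (semi_brace_of_affine B (sb_sigma B)) B \<and>
    (cancellative_affine_structure B (sb_sigma B) \<longleftrightarrow> left_cancellative_semi_brace B) \<and>
    (groupal_affine_structure B (sb_sigma B) \<longleftrightarrow> skew_brace B)"
proof -
  interpret semi_brace B by (rule assms)
  have "same_semi_brace (semi_brace_of_affine B (sb_sigma B)) B"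
    by (simp add: same_semi_brace_def semi_brace_of_affine_def add_eq_mult_sb_sigma)
  then show ?thesis
    using affine_structure_sb_sigma add_eq_mult_sb_sigma sigma.semi_brace_semi_brace_of_affine
      cancellative_iff_left_cancellative groupal_iff_skew_brace
    by blast
qed

end
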